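(* The category $\mathbf{BornCoarse}$ of bornological coarse spaces does not have a final object.
   Context: For a set $X$, subsets $U,V\subseteq X\times X$ and $B\subseteq X$ put $U^{-1}=\{(x,y)\mid (y,x)\in U\}$, $U\circ V=\{(x,y)\mid \exists z\in X:(x,z)\in U,(z,y)\in V\}$, and $U[B]=\{x\in X\mid\exists b\in B:(x,b)\in U\}$. A bornology on $X$ is a set $\mathcal{B}_X$ of subsets of $X$ (called bounded) containing all finite subsets and closed under taking subsets and finite unions. A coarse structure on $X$ is a set $\mathcal{C}_X$ of subsets of $X\times X$ (called entourages) containing the diagonal and closed under taking subsets, finite unions, inverses and compositions. They are compatible if $U[B]\in\mathcal{B}_X$ for all $U\in\mathcal{C}_X$, $B\in\mathcal{B}_X$. A bornological coarse space is a set with a coarse structure and a compatible bornology. A morphism $f\colon X\to Y$ is a map that is proper ($f^{-1}(B)\in\mathcal{B}_X$ for all $B\in\mathcal{B}_Y$) and controlled ($(f\times f)(U)\in\mathcal{C}_Y$ for all $U\in\mathcal{C}_X$). This defines the category $\mathbf{BornCoarse}$. *)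

theory Defs
  imports Main "HOL-Library.FuncSet"
begin

definition bornology :: "'a set \<Rightarrow> 'a set set \<Rightarrow> bool" where
  "bornology X \<B> \<longleftrightarrow>
     \<B> \<subseteq> Pow X \<and>
     (\<forall>B. finite B \<and> B \<subseteq> X \<longrightarrow> B \<in> \<B>) \<and>
     (\<forall>B\<in>\<B>. \<forall>A. A \<subseteq> B \<longrightarrow> A \<in> \<B>) \<and>
     (\<forall>A\<in>\<B>. \<forall>B\<in>\<B>. A \<union> B \<in> \<B>)"

definition coarse_structure :: "'a set \<Rightarrow> ('a \<times> 'a) set set \<Rightarrow> bool" where
  "coarse_structure X \<C> \<longleftrightarrow>
     \<C> \<subseteq> Pow (X \<times> X) \<and>
     Id_on X \<in> \<C> \<and>
     (\<forall>U\<in>\<C>. \<forall>V. V \<subseteq> U \<longrightarrow> V \<in> \<C>) \<and>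
     (\<forall>U\<in>\<C>. \<forall>V\<in>\<C>. U \<union> V \<in> \<C>) \<and>
     (\<forall>U\<in>\<C>. U\<inverse> \<in> \<C>) \<and>
     (\<forall>U\<in>\<C>. \<forall>V\<in>\<C>. U O V \<in> \<C>)"

text \<open>Note the side: \<open>U[B]\<close> collects first components, so it is the relational image of \<open>B\<close>
  under the converse of \<open>U\<close>.\<close>

definition thickening :: "'a set \<Rightarrow> ('a \<times> 'a) set \<Rightarrow> 'a set \<Rightarrow> 'a set" where
  "thickening X U B = {x \<in> X. \<exists>b\<in>B. (x, b) \<in> U}"

definition compatible :: "'a set \<Rightarrow> ('a \<times> 'a) set set \<Rightarrow> 'a set set \<Rightarrow> bool" where
  "compatible X \<C> \<B> \<longleftrightarrow> (\<forall>U\<in>\<C>. \<forall>B\<in>\<B>. thickening X U B \<in> \<B>)"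

record 'a bc_space =
  points :: "'a set"
  entourages :: "('a \<times> 'a) set set"
  boundeds :: "'a set set"

definition born_coarse_space :: "'a bc_space \<Rightarrow> bool" where
  "born_coarse_space X \<longleftrightarrow>
     coarse_structure (points X) (entourages X) \<and>
     bornology (points X) (boundeds X) \<and>
     compatible (points X) (entourages X) (boundeds X)"

definition proper_map :: "'a bc_space \<Rightarrow> 'b bc_space \<Rightarrow> ('a \<Rightarrow> 'b) \<Rightarrow> bool" where
  "proper_map X Y f \<longleftrightarrow> (\<forall>B\<in>boundeds Y. f -` B \<inter> points X \<in> boundeds X)"

definition controlled_map :: "'a bc_space \<Rightarrow> 'b bc_space \<Rightarrow> ('a \<Rightarrow> 'b) \<Rightarrow> bool" where
  "controlled_map X Y f \<longleftrightarrow> (\<forall>U\<in>entourages X. map_prod f f ` U \<in> entourages Y)"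

text \<open>Maps between carriers are extensional functions, so that equality of HOL functions is
  equality of maps; this matters for the uniqueness part of finality.\<close>

definition bc_morphisms :: "'a bc_space \<Rightarrow> 'b bc_space \<Rightarrow> ('a \<Rightarrow> 'b) set" where
  "bc_morphisms X Y =
     {f \<in> points X \<rightarrow>\<^sub>E points Y. proper_map X Y f \<and> controlled_map X Y f}"

record ('o, 'm) cat =
  Obj :: "'o set"
  Hom :: "'o \<Rightarrow> 'o \<Rightarrow> 'm set"
  Ident :: "'o \<Rightarrow> 'm"
  Comp :: "'o \<Rightarrow> 'o \<Rightarrow> 'o \<Rightarrow> 'm \<Rightarrow> 'm \<Rightarrow> 'm"  \<comment> \<open>\<open>Comp C X Y Z g f\<close> is \<open>g \<circ> f : X \<rightarrow> Y \<rightarrow> Z\<close>\<close>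

definition is_category :: "('o, 'm) cat \<Rightarrow> bool" where
  "is_category C \<longleftrightarrow>
     (\<forall>X\<in>Obj C. Ident C X \<in> Hom C X X) \<and>
     (\<forall>X\<in>Obj C. \<forall>Y\<in>Obj C. \<forall>Z\<in>Obj C. \<forall>f\<in>Hom C X Y. \<forall>g\<in>Hom C Y Z.
        Comp C X Y Z g f \<in> Hom C X Z) \<and>
     (\<forall>X\<in>Obj C. \<forall>Y\<in>Obj C. \<forall>f\<in>Hom C X Y.
        Comp C X X Y f (Ident C X) = f \<and> Comp C X Y Y (Ident C Y) f = f) \<and>
     (\<forall>W\<in>Obj C. \<forall>X\<in>Obj C. \<forall>Y\<in>Obj C. \<forall>Z\<in>Obj C.
        \<forall>f\<in>Hom C W X. \<forall>g\<in>Hom C X Y. \<forall>h\<in>Hom C Y Z.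
        Comp C W Y Z h (Comp C W X Y g f) = Comp C W X Z (Comp C X Y Z h g) f)"

definition final_object :: "('o, 'm) cat \<Rightarrow> 'o \<Rightarrow> bool" where
  "final_object C F \<longleftrightarrow> F \<in> Obj C \<and> (\<forall>X\<in>Obj C. \<exists>!f. f \<in> Hom C X F)"

text \<open>The type \<open>'u\<close> plays the role of the universe of small sets: the objects are all
  bornological coarse spaces whose underlying set is a subset of \<open>'u\<close>. The category of sets
  contains infinite sets, so \<open>'u\<close> has to be infinite for this to model
  the category of bornological coarse spaces. (Over a finite type every bornology is the full
  power set, and a one-point space would be final.)\<close>

definition BornCoarse :: "('u bc_space, 'u \<Rightarrow> 'u) cat" where
  "BornCoarse =
     \<lparr>Obj = {X. born_coarse_space X},
      Hom = bc_morphisms,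
      Ident = (\<lambda>X. restrict (\<lambda>x. x) (points X)),
      Comp = (\<lambda>X Y Z g f. compose (points X) g f)\<rparr>"

lemma boundeds_subset:
  assumes "born_coarse_space X" "B \<in> boundeds X"
  shows "B \<subseteq> points X"
proof -
  have "boundeds X \<subseteq> Pow (points X)"
    using assms(1) unfolding born_coarse_space_def bornology_def by (elim conjE)
  then show ?thesis using assms(2) by blast
qed

lemma entourages_subset:
  assumes "born_coarse_space X" "U \<in> entourages X"
  shows "U \<subseteq> points X \<times> points X"
proof -
  have "entourages X \<subseteq> Pow (points X \<times> points X)"
    using assms(1) unfolding born_coarse_space_def coarse_structure_def by (elim conjE)
  then show ?thesis using assms(2) by blast
qed

lemma bc_morphisms_id:
  assumes "born_coarse_space X"
  shows "restrict (\<lambda>x. x) (points X) \<in> bc_morphisms X X"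
proof -
  let ?i = "restrict (\<lambda>x. x) (points X)"
  have "?i -` B \<inter> points X = B" if "B \<in> boundeds X" for B
    using boundeds_subset[OF assms that] by auto
  moreover have "map_prod ?i ?i ` U = U" if "U \<in> entourages X" for U
  proof -
    have U: "U \<subseteq> points X \<times> points X"
      using assms that by (rule entourages_subset)
    have "map_prod ?i ?i ` U = id ` U"
      using U by (intro image_cong) auto
    then show ?thesis by simp
  qed
  ultimately show ?thesis
    by (auto simp: bc_morphisms_def proper_map_def controlled_map_def)
qed

lemma bc_morphisms_compose:
  assumes X: "born_coarse_space X"
    and f: "f \<in> bc_morphisms X Y" and g: "g \<in> bc_morphisms Y Z"
  shows "compose (points X) g f \<in> bc_morphisms X Z"
proof -
  let ?h = "compose (points X) g f"
  have fm: "f \<in> points X \<rightarrow> points Y" and gm: "g \<in> points Y \<rightarrow> points Z"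
    using f g by (auto simp: bc_morphisms_def)
  have "?h -` B \<inter> points X \<in> boundeds X" if "B \<in> boundeds Z" for B
  proof -
    have "?h -` B \<inter> points X = f -` (g -` B \<inter> points Y) \<inter> points X"
      using fm by (auto simp: compose_def)
    moreover have "g -` B \<inter> points Y \<in> boundeds Y"
      using g that by (simp add: bc_morphisms_def proper_map_def)
    then have "f -` (g -` B \<inter> points Y) \<inter> points X \<in> boundeds X"
      using f unfolding bc_morphisms_def proper_map_def by blast
    ultimately show ?thesis by simp
  qed
  moreover have "map_prod ?h ?h ` U \<in> entourages Z" if "U \<in> entourages X" for U
  proof -
    have U: "U \<subseteq> points X \<times> points X"
      using X that by (rule entourages_subset)
    have "map_prod ?h ?h ` U = map_prod g g ` map_prod f f ` U"
      unfolding image_image using U by (intro image_cong) (auto simp: compose_def)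
    then show ?thesis
      using f g that by (simp add: bc_morphisms_def controlled_map_def)
  qed
  moreover have "?h \<in> points X \<rightarrow>\<^sub>E points Z"
    using fm gm by (auto simp: compose_def)
  ultimately show ?thesis
    by (simp add: bc_morphisms_def proper_map_def controlled_map_def)
qed

lemma is_category_BornCoarse: "is_category BornCoarse"
  unfolding is_category_def BornCoarse_def cat.simps
proof (intro conjI ballI; (unfold mem_Collect_eq)?)
  fix X :: "'a bc_space"
  assume "born_coarse_space X"
  then show "restrict (\<lambda>x. x) (points X) \<in> bc_morphisms X X"
    by (rule bc_morphisms_id)
next
  fix X Y Z :: "'a bc_space" and f g
  assume "born_coarse_space X" "f \<in> bc_morphisms X Y" "g \<in> bc_morphisms Y Z"
  then show "compose (points X) g f \<in> bc_morphisms X Z"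
    by (rule bc_morphisms_compose)
next
  fix X Y :: "'a bc_space" and f
  assume f: "f \<in> bc_morphisms X Y"
  then have *: "f \<in> points X \<rightarrow> points Y" "f \<in> extensional (points X)"
    by (simp_all add: bc_morphisms_def PiE_iff Pi_iff)
  show "compose (points X) f (restrict (\<lambda>x. x) (points X)) = f"
    by (rule compose_Id[OF *])
  show "compose (points X) (restrict (\<lambda>x. x) (points Y)) f = f"
    by (rule Id_compose[OF *])
next
  fix W X Y Z :: "'a bc_space" and f g h
  assume "f \<in> bc_morphisms W X"
  then have "f \<in> points W \<rightarrow> points X"
    by (simp add: bc_morphisms_def PiE_iff Pi_iff)
  then show "compose (points W) h (compose (points W) g f)
      = compose (points W) (compose (points X) h g) f"
    by (rule compose_assoc)
qed

end

theory Submission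
  imports Defs
begin

text \<open>The maps out of a one-point space are exactly the points of the target, so a final object
  has at most one point and is therefore bounded. By properness, every space is then bounded; but
  an infinite set with the bornology of its finite subsets is not.\<close>

text \<open>The smallest coarse structure together with the smallest bornology on \<open>S\<close>.
  Maps from it into a bornological coarse space are controlled for free, while properness is as
  demanding as possible.\<close>

definition discrete_min_space :: "'a set \<Rightarrow> 'a bc_space" where
  "discrete_min_space S =
     \<lparr>points = S, entourages = Pow (Id_on S), boundeds = {B. finite B \<and> B \<subseteq> S}\<rparr>"

lemma born_coarse_space_discrete_min: "born_coarse_space (discrete_min_space S)"
proof -
  have "coarse_structure S (Pow (Id_on S))"
    unfolding coarse_structure_def by blast
  moreover have "bornology S {B. finite B \<and> B \<subseteq> S}"
    unfolding bornology_def by (auto intro: finite_subset)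
  moreover have "thickening S U B \<subseteq> B" if "U \<subseteq> Id_on S" for U B
    using that unfolding thickening_def by blast
  then have "compatible S (Pow (Id_on S)) {B. finite B \<and> B \<subseteq> S}"
    unfolding compatible_def by (blast intro: finite_subset)
  ultimately show ?thesis
    by (simp add: born_coarse_space_def discrete_min_space_def)
qed

lemma finite_points_bounded:
  assumes "born_coarse_space X" "finite (points X)"
  shows "points X \<in> boundeds X"
  using assms by (simp add: born_coarse_space_def bornology_def)

text \<open>Diagonal pairs go to diagonal pairs, so \<open>f\<close> is controlled; it is proper
  because every subset of a finite \<open>S\<close> is bounded.\<close>

lemma bc_morphisms_from_finite_discrete:
  assumes Y: "born_coarse_space Y" and "finite S" and f: "f \<in> S \<rightarrow>\<^sub>E points Y"
  shows "f \<in> bc_morphisms (discrete_min_space S) Y"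
proof -
  have diag: "Id_on (points Y) \<in> entourages Y"
    and sub: "\<And>U V. U \<in> entourages Y \<Longrightarrow> V \<subseteq> U \<Longrightarrow> V \<in> entourages Y"
    using Y by (simp_all add: born_coarse_space_def coarse_structure_def)
  have "map_prod f f ` U \<in> entourages Y" if "U \<subseteq> Id_on S" for U
    using that f by (intro sub[OF diag]) (auto simp: Id_on_def)
  then show ?thesis
    using assms
    by (simp add: bc_morphisms_def proper_map_def controlled_map_def discrete_min_space_def)
qed

theorem lemma3p1:
  assumes "infinite (UNIV :: 'u set)"
  shows "\<not> (\<exists>F. final_object (BornCoarse :: ('u bc_space, 'u \<Rightarrow> 'u) cat) F)"
proof
  assume "\<exists>F. final_object (BornCoarse :: ('u bc_space, 'u \<Rightarrow> 'u) cat) F"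
  then obtain F where "final_object (BornCoarse :: ('u bc_space, 'u \<Rightarrow> 'u) cat) F" ..
  then have F: "born_coarse_space F"
    and ex1: "\<And>X :: 'u bc_space. born_coarse_space X \<Longrightarrow> \<exists>!f. f \<in> bc_morphisms X F"
    by (simp_all add: final_object_def BornCoarse_def)
  have "p = q" if pq: "p \<in> points F" "q \<in> points F" for p q
  proof -
    \<comment> \<open>Objects have their points in \<open>'u\<close>, so \<open>p\<close> itself
      serves as the single point of the source. Uniqueness of the map into \<open>F\<close> then
      identifies the constant maps to \<open>p\<close> and \<open>q\<close>.\<close>
    have "restrict (\<lambda>_. r) {p} \<in> bc_morphisms (discrete_min_space {p}) F"
      if "r \<in> points F" for r
      using that by (intro bc_morphisms_from_finite_discrete[OF F]) auto
    then have "restrict (\<lambda>_. p) {p} = restrict (\<lambda>_. q) {p}"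
      using ex1[OF born_coarse_space_discrete_min, of "{p}"] pq by (metis (no_types))
    then show ?thesis by (metis restrict_apply' singletonI)
  qed
  then have "points F \<subseteq> {p}" if "p \<in> points F" for p
    using that by blast
  \<comment> \<open>Either \<open>points F\<close> is empty or some \<open>p\<close> in it gives the
    bound by a singleton.\<close>
  then have "finite (points F)"
    by (metis all_not_in_conv finite.emptyI finite.insertI finite_subset)
  with F have "points F \<in> boundeds F"
    by (rule finite_points_bounded)
  \<comment> \<open>Existence of a map is used here. Its domain is all of \<open>'u\<close>, so the
    preimage of \<open>points F\<close> is \<open>UNIV\<close>, while properness makes this preimage
    finite.\<close>
  moreover obtain f where "f \<in> bc_morphisms (discrete_min_space (UNIV :: 'u set)) F"
    using ex1[OF born_coarse_space_discrete_min] by blast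
  ultimately have "finite (f -` points F)" and "f -` points F = UNIV"
    by (auto simp: bc_morphisms_def proper_map_def discrete_min_space_def)
  then show False using assms by simp
qed

end
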